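(* For every positive integer $d$ there exists a monic polynomial $f_d(x)$ of degree $d$ with integer coefficients such that $\alpha_n^d=f_d(n)$ for all positive integers $n$ that are relatively prime to every nonzero determinant of a $d\times d$ matrix with entries in $\{0,1\}$.
   Context: For a positive integer $n$, $\mathbb{Z}_n$ is the ring of integers modulo $n$; a vector $(v_1,\dots,v_d)\in\mathbb{Z}_n^d$ is zero-sum-free if no non-empty subset of its components sums to $0$ in $\mathbb{Z}_n$; $\alpha_n^d$ is the number of such vectors. *)

theory Defs
  imports "Jordan_Normal_Form.Determinant" "HOL-Number_Theory.Cong"
begin

text \<open>The ring of integers modulo \<open>n\<close> is represented by the canonical residues
  \<open>0, \<dots>, n - 1\<close>; addition is integer addition followed by reduction modulo \<open>n\<close>.\<close>

definition Zn_vectors :: "nat \<Rightarrow> nat \<Rightarrow> int vec set" where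
  "Zn_vectors n d = {v \<in> carrier_vec d. \<forall>i<d. v $ i \<in> {0..<int n}}"

text \<open>Subsets of the components are indexed by sets of positions, so that equal components
  at different positions are counted separately.\<close>

definition zero_sum_free :: "nat \<Rightarrow> int vec \<Rightarrow> bool" where
  "zero_sum_free n v \<longleftrightarrow>
    (\<forall>I. I \<subseteq> {..<dim_vec v} \<and> I \<noteq> {} \<longrightarrow> \<not> [(\<Sum>i\<in>I. v $ i) = 0] (mod int n))"

definition alpha :: "nat \<Rightarrow> nat \<Rightarrow> nat" where
  "alpha n d = card {v \<in> Zn_vectors n d. zero_sum_free n v}"

definition zero_one_matrices :: "nat \<Rightarrow> int mat set" where
  "zero_one_matrices d = {A \<in> carrier_mat d d. \<forall>i<d. \<forall>j<d. A $$ (i, j) \<in> {0, 1}}"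

end

theory Submission imports Defs begin

text \<open>
  By inclusion-exclusion, \<open>\<alpha>\<^sub>n\<^sup>d\<close> is the alternating sum, over all sets \<open>S\<close> of nonzero
  0-1 vectors, of the number of \<open>v\<close> modulo \<open>n\<close> that are orthogonal to \<open>S\<close>.  To count these, choose
  among the \<open>d \<times> d\<close> 0-1 matrices with nonzero determinant a matrix \<open>A\<close> with as many rows in \<open>S\<close>
  as possible, say \<open>k\<close>.  Write \<open>det A \<cdot> s\<close>, for \<open>s \<in> S\<close>, as a combination of the rows of \<open>A\<close> by
  Cramer's rule: the coefficient of row \<open>i\<close> is the determinant of \<open>A\<close> with row \<open>i\<close> replaced by
  \<open>s\<close>, which by maximality vanishes unless row \<open>i\<close> already lies in \<open>S\<close>.  As \<open>det A\<close> is invertible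
  modulo \<open>n\<close>, \<open>v\<close> is orthogonal to \<open>S\<close> iff \<open>k\<close> fixed coordinates of \<open>A v\<close> vanish, and
  \<open>v \<mapsto> A v\<close> is a bijection; so there are \<open>n\<^bsup>d-k\<^esup>\<close> solutions, and \<open>k > 0\<close> unless \<open>S\<close> is empty.
\<close>

section \<open>Row replacement and Cramer's rule without division\<close>

definition replace_row :: "'a mat \<Rightarrow> nat \<Rightarrow> 'a vec \<Rightarrow> 'a mat" where
  "replace_row A i s =
    mat (dim_row A) (dim_col A) (\<lambda>(k, j). if k = i then s $ j else A $$ (k, j))"

lemma replace_row_carrier [simp]:
  "A \<in> carrier_mat m n \<Longrightarrow> replace_row A i s \<in> carrier_mat m n"
  by (auto simp: replace_row_def)

lemma row_replace_row:
  assumes "A \<in> carrier_mat m n" "s \<in> carrier_vec n" "k < m"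
  shows "row (replace_row A i s) k = (if k = i then s else row A k)"
  using assms by (intro eq_vecI) (auto simp: replace_row_def)

text \<open>Laplace expansion along row \<open>i\<close>: the cofactors of that row do not involve
  its entries, so they are those of \<open>A\<close>, which form column \<open>i\<close> of
  \<open>adj_mat A\<close>.\<close>

lemma det_replace_row:
  fixes A :: "'a :: comm_ring_1 mat"
  assumes A: "A \<in> carrier_mat d d" and i: "i < d"
  shows "det (replace_row A i s) = (\<Sum>k<d. s $ k * adj_mat A $$ (k, i))"
proof -
  have "mat_delete (replace_row A i s) i k = mat_delete A i k" for k
    using A i by (auto simp: mat_delete_def replace_row_def)
  then have "cofactor (replace_row A i s) i k = cofactor A i k" for k
    by (simp add: cofactor_def)
  then have "det (replace_row A i s) = (\<Sum>k<d. replace_row A i s $$ (i, k) * cofactor A i k)"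
    using laplace_expansion_row[OF replace_row_carrier[OF A] i] by simp
  also have "\<dots> = (\<Sum>k<d. s $ k * adj_mat A $$ (k, i))"
    using A i by (intro sum.cong) (auto simp: replace_row_def adj_mat_def)
  finally show ?thesis .
qed

text \<open>Follows from \<open>adj_mat A * A\<close> being \<open>det A\<close> times the identity.
  No division occurs, so the integer identity can later be reduced modulo \<open>n\<close>.\<close>

lemma det_mult_scalar_prod:
  fixes A :: "'a :: comm_ring_1 mat"
  assumes A: "A \<in> carrier_mat d d" and s: "s \<in> carrier_vec d" and v: "v \<in> carrier_vec d"
  shows "det A * (s \<bullet> v) = (\<Sum>i<d. det (replace_row A i s) * (row A i \<bullet> v))"
proof -
  have "(det A \<cdot>\<^sub>m 1\<^sub>m d) *\<^sub>v v = det A \<cdot>\<^sub>v v"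
    using v by (intro eq_vecI) auto
  then have "det A * (s \<bullet> v) = s \<bullet> ((adj_mat A * A) *\<^sub>v v)"
    using s v by (simp add: adj_mat(3)[OF A])
  also have "\<dots> = s \<bullet> (adj_mat A *\<^sub>v (A *\<^sub>v v))"
    using A v adj_mat(1)[OF A] by (simp add: assoc_mult_mat_vec)
  also have "\<dots> = (\<Sum>k<d. \<Sum>i<d. s $ k * (adj_mat A $$ (k, i) * (row A i \<bullet> v)))"
    using A s v adj_mat(1)[OF A]
    by (simp add: scalar_prod_def[of s] scalar_prod_def[of "row (adj_mat A) _"]
        sum_distrib_left lessThan_atLeast0)
  also have "\<dots> = (\<Sum>i<d. \<Sum>k<d. s $ k * (adj_mat A $$ (k, i) * (row A i \<bullet> v)))"
    by (rule sum.swap)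
  also have "\<dots> = (\<Sum>i<d. det (replace_row A i s) * (row A i \<bullet> v))"
    by (simp add: det_replace_row[OF A] sum_distrib_right mult.assoc)
  finally show ?thesis .
qed

section \<open>0-1 vectors and the extremal choice of a matrix\<close>

definition zero_one_vectors :: "nat \<Rightarrow> int vec set" where
  "zero_one_vectors d = {s \<in> carrier_vec d. \<forall>j<d. s $ j \<in> {0, 1}}"

lemma replace_row_zero_one:
  assumes "A \<in> zero_one_matrices d" "s \<in> zero_one_vectors d"
  shows "replace_row A i s \<in> zero_one_matrices d"
  using assms unfolding zero_one_matrices_def zero_one_vectors_def replace_row_def by fastforce

text \<open>Positions are collected rather than rows, since they later index the coordinates of
  \<open>A v\<close> that must vanish.\<close>

definition rows_in :: "int mat \<Rightarrow> int vec set \<Rightarrow> nat set" where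
  "rows_in A S = {i. i < dim_row A \<and> row A i \<in> S}"

lemma exists_maximal_rows:
  assumes S: "S \<subseteq> zero_one_vectors d"
  obtains A where "A \<in> zero_one_matrices d" "det A \<noteq> 0"
    "\<And>i s. i < d \<Longrightarrow> i \<notin> rows_in A S \<Longrightarrow> s \<in> S \<Longrightarrow> det (replace_row A i s) = 0"
proof -
  define good where "good A \<longleftrightarrow> A \<in> zero_one_matrices d \<and> det A \<noteq> 0" for A
  \<comment> \<open>The identity is a first candidate, and \<open>d\<close> bounds the number of
    rows in \<open>S\<close>, so a maximum is attained.\<close>
  have "good (1\<^sub>m d)"
    by (auto simp: good_def zero_one_matrices_def)
  moreover have "\<forall>A. good A \<longrightarrow> card (rows_in A S) < Suc d"
  proof (intro allI impI)
    fix A assume "good A"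
    then have "rows_in A S \<subseteq> {..<d}"
      by (auto simp: good_def zero_one_matrices_def rows_in_def)
    then show "card (rows_in A S) < Suc d"
      using card_mono[of "{..<d}" "rows_in A S"] by simp
  qed
  ultimately obtain A where A: "good A"
    and max: "\<And>B. good B \<Longrightarrow> card (rows_in B S) \<le> card (rows_in A S)"
    using ex_has_greatest_nat[of good "1\<^sub>m d" "\<lambda>A. card (rows_in A S)" "Suc d"]
    by (metis less_imp_le)
  have Ac: "A \<in> carrier_mat d d"
    using A by (simp add: good_def zero_one_matrices_def)
  have "det (replace_row A i s) = 0" if i: "i < d" "i \<notin> rows_in A S" and s: "s \<in> S" for i s
  proof (rule ccontr)
    assume "det (replace_row A i s) \<noteq> 0"
    then have "good (replace_row A i s)"
      using A S s replace_row_zero_one by (auto simp: good_def)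
    \<comment> \<open>Position \<open>i\<close> is gained and none is lost, which contradicts
      maximality.\<close>
    moreover have "rows_in (replace_row A i s) S = insert i (rows_in A S)"
    proof -
      have sc: "s \<in> carrier_vec d"
        using S s by (auto simp: zero_one_vectors_def)
      have dim: "dim_row A = d" "dim_row (replace_row A i s) = d"
        using Ac replace_row_carrier[OF Ac, of i s] by (auto simp del: replace_row_carrier)
      show ?thesis
        using i s by (auto simp: rows_in_def dim row_replace_row[OF Ac sc] split: if_splits)
    qed
    moreover have "finite (rows_in A S)"
      by (simp add: rows_in_def)
    ultimately show False
      using max[of "replace_row A i s"] i by simp
  qed
  then show thesis
    using A that by (auto simp: good_def)
qed

section \<open>Counting residue vectors and inverting a matrix modulo \<open>n\<close>\<close>

lemma Zn_vectors_eq_image: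
  "{w \<in> Zn_vectors n d. \<forall>i\<in>K. w $ i = 0} =
    vec d ` (\<Pi>\<^sub>E i\<in>{..<d}. {0..<int n} \<inter> (if i \<in> K then {0} else UNIV))"
  if "K \<subseteq> {..<d}"
proof (intro equalityI subsetI)
  fix w assume w: "w \<in> {w \<in> Zn_vectors n d. \<forall>i\<in>K. w $ i = 0}"
  then have "w = vec d (restrict (($) w) {..<d})"
    by (intro eq_vecI) (auto simp: Zn_vectors_def)
  moreover have "restrict (($) w) {..<d} \<in>
      (\<Pi>\<^sub>E i\<in>{..<d}. {0..<int n} \<inter> (if i \<in> K then {0} else UNIV))"
    using w by (auto simp: Zn_vectors_def)
  ultimately show "w \<in> vec d ` (\<Pi>\<^sub>E i\<in>{..<d}. {0..<int n} \<inter> (if i \<in> K then {0} else UNIV))"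
    by (rule image_eqI)
next
  fix w assume "w \<in> vec d ` (\<Pi>\<^sub>E i\<in>{..<d}. {0..<int n} \<inter> (if i \<in> K then {0} else UNIV))"
  then obtain f where f: "w = vec d f"
    "f \<in> (\<Pi>\<^sub>E i\<in>{..<d}. {0..<int n} \<inter> (if i \<in> K then {0} else UNIV))" by blast
  have "f i \<in> {0..<int n} \<inter> (if i \<in> K then {0} else UNIV)" if "i < d" for i
    using f(2) that by (auto simp: PiE_iff)
  then show "w \<in> {w \<in> Zn_vectors n d. \<forall>i\<in>K. w $ i = 0}"
    using that by (fastforce simp: Zn_vectors_def f(1))
qed

lemma finite_Zn_vectors [simp]: "finite (Zn_vectors n d)"
proof -
  have "finite {w \<in> Zn_vectors n d. \<forall>i\<in>{}. w $ i = 0}"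
    by (subst Zn_vectors_eq_image) (auto intro!: finite_PiE)
  then show ?thesis by simp
qed

text \<open>In the description as a product, a position in \<open>K\<close> leaves one choice and
  any other position leaves \<open>n\<close>.\<close>

lemma card_Zn_vectors_zero_on:
  assumes "n > 0" and K: "K \<subseteq> {..<d}"
  shows "card {w \<in> Zn_vectors n d. \<forall>i\<in>K. w $ i = 0} = n ^ (d - card K)"
proof -
  have "inj_on (vec d) (\<Pi>\<^sub>E i\<in>{..<d}. {0..<int n} \<inter> (if i \<in> K then {0} else UNIV))"
  proof (rule inj_onI)
    fix f g assume fg: "f \<in> (\<Pi>\<^sub>E i\<in>{..<d}. {0..<int n} \<inter> (if i \<in> K then {0} else UNIV))"
      "g \<in> (\<Pi>\<^sub>E i\<in>{..<d}. {0..<int n} \<inter> (if i \<in> K then {0} else UNIV))" "vec d f = vec d g"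
    have "f i = g i" if "i < d" for i
      using fg(3) that by (metis index_vec)
    then show "f = g"
      using fg(1,2) by (intro PiE_ext) auto
  qed
  then have "card {w \<in> Zn_vectors n d. \<forall>i\<in>K. w $ i = 0} =
      (\<Prod>i<d. card ({0..<int n} \<inter> (if i \<in> K then {0} else UNIV)))"
    by (simp add: Zn_vectors_eq_image[OF K] card_image card_PiE)
  also have "\<dots> = (\<Prod>i<d. if i \<in> K then 1 else n)"
    using assms by (intro prod.cong) auto
  also have "\<dots> = n ^ card ({..<d} - K)"
    by (simp add: prod.If_cases Diff_eq)
  also have "card ({..<d} - K) = d - card K"
    using K by (simp add: card_Diff_subset finite_subset)
  finally show ?thesis .
qed

text \<open>The set is finite and mapped into itself, so injectivity is enough.\<close>

lemma scalar_prod_mod_bij: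
  assumes A: "A \<in> carrier_mat d d" and n: "n > 0" and cop: "coprime (int n) (det A)"
  shows "bij_betw (\<lambda>v. vec d (\<lambda>i. (row A i \<bullet> v) mod int n)) (Zn_vectors n d) (Zn_vectors n d)"
proof -
  define F where "F v = vec d (\<lambda>i. (row A i \<bullet> v) mod int n)" for v
  have sub: "F ` Zn_vectors n d \<subseteq> Zn_vectors n d"
    using n by (auto simp: F_def Zn_vectors_def)
  have "inj_on F (Zn_vectors n d)"
  proof (rule inj_onI)
    fix v w assume v: "v \<in> Zn_vectors n d" and w: "w \<in> Zn_vectors n d" and eq: "F v = F w"
    have vc: "v \<in> carrier_vec d" and wc: "w \<in> carrier_vec d"
      using v w by (auto simp: Zn_vectors_def)
    have row: "[row A i \<bullet> v = row A i \<bullet> w] (mod int n)" if "i < d" for i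
      using arg_cong[OF eq, of "\<lambda>x. x $ i"] that by (simp add: F_def cong_def)
    show "v = w"
    proof (rule eq_vecI)
      fix j assume "j < dim_vec w"
      then have j: "j < d" using wc by simp
      have uc: "unit_vec d j \<in> carrier_vec d" by simp
      \<comment> \<open>At a unit vector, Cramer's rule recovers \<open>det A\<close> times entry
        \<open>j\<close> from the products with the rows, which agree modulo \<open>n\<close>; then
        \<open>det A\<close> cancels.\<close>
      have "[det A * (unit_vec d j \<bullet> v) = det A * (unit_vec d j \<bullet> w)] (mod int n)"
        unfolding det_mult_scalar_prod[OF A uc vc] det_mult_scalar_prod[OF A uc wc]
        by (intro cong_sum cong_mult row cong_refl) auto
      then have "[v $ j = w $ j] (mod int n)"
        using cop j vc wc by (simp add: cong_mult_lcancel coprime_commute)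
      then show "v $ j = w $ j"
        using v w j by (intro cong_less_imp_eq_int) (auto simp: Zn_vectors_def)
    qed (use vc wc in auto)
  qed
  then have "bij_betw F (Zn_vectors n d) (Zn_vectors n d)"
    using sub by (simp add: bij_betw_def endo_inj_surj)
  then show ?thesis by (simp add: F_def[abs_def])
qed

section \<open>Homogeneous 0-1 systems modulo \<open>n\<close>\<close>

definition solutions_mod :: "nat \<Rightarrow> nat \<Rightarrow> int vec set \<Rightarrow> int vec set" where
  "solutions_mod n d S = {v \<in> Zn_vectors n d. \<forall>s\<in>S. [s \<bullet> v = 0] (mod int n)}"

text \<open>The exponent \<open>r\<close> is obtained before \<open>n\<close>, so that one monomial
  serves all admissible \<open>n\<close>. The bound \<open>r < d\<close> excludes the zero vector
  from \<open>S\<close> because that vector imposes no condition.\<close>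

lemma card_solutions_mod:
  assumes S: "S \<subseteq> zero_one_vectors d"
  obtains r where "r \<le> d" "S \<noteq> {} \<Longrightarrow> 0\<^sub>v d \<notin> S \<Longrightarrow> r < d"
    "\<And>n. n > 0 \<Longrightarrow> (\<And>A. A \<in> zero_one_matrices d \<Longrightarrow> det A \<noteq> 0 \<Longrightarrow> coprime (int n) (det A))
      \<Longrightarrow> card (solutions_mod n d S) = n ^ r"
proof -
  obtain A where A: "A \<in> zero_one_matrices d" "det A \<noteq> 0" and
    max: "\<And>i s. i < d \<Longrightarrow> i \<notin> rows_in A S \<Longrightarrow> s \<in> S \<Longrightarrow> det (replace_row A i s) = 0"
    using exists_maximal_rows[OF S] by blast
  have Ac: "A \<in> carrier_mat d d"
    using A by (simp add: zero_one_matrices_def)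
  define K where "K = rows_in A S"
  have K: "K \<subseteq> {..<d}"
    using Ac by (auto simp: K_def rows_in_def)
  have expand: "det A * (s \<bullet> v) = (\<Sum>i\<in>K. det (replace_row A i s) * (row A i \<bullet> v))"
    if s: "s \<in> S" and v: "v \<in> carrier_vec d" for s v
  proof -
    have "s \<in> carrier_vec d"
      using S s by (auto simp: zero_one_vectors_def)
    from det_mult_scalar_prod[OF Ac this v] show ?thesis
      using max s K by (simp add: K_def sum.mono_neutral_right)
  qed
  show thesis
  proof (rule that[of "d - card K"])
    show "d - card K < d" if ne: "S \<noteq> {}" and zero: "0\<^sub>v d \<notin> S"
    proof -
      obtain s where s: "s \<in> S" using ne by blast
      have sc: "s \<in> carrier_vec d"
        using S s by (auto simp: zero_one_vectors_def)
      obtain j where j: "j < d" "s $ j \<noteq> 0"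
      proof (rule ccontr)
        assume "\<not> thesis"
        then have "s = 0\<^sub>v d"
          using sc that by (intro eq_vecI) auto
        with s zero show False by simp
      qed
      \<comment> \<open>With \<open>K\<close> empty, the expansion at \<open>unit_vec d j\<close>
        would make \<open>det A * s $ j\<close> zero, though both factors are nonzero.\<close>
      have "K \<noteq> {}"
        using expand[OF s, of "unit_vec d j"] j sc A(2) by auto
      then have "card K > 0"
        using K by (simp add: card_gt_0_iff finite_subset)
      \<comment> \<open>Here \<open>j < d\<close> supplies \<open>d > 0\<close>, so the truncated
        subtraction strictly decreases \<open>d\<close>.\<close>
      with j show ?thesis by simp
    qed
  next
    fix n :: nat assume n: "n > 0"
      and cop: "\<And>A. A \<in> zero_one_matrices d \<Longrightarrow> det A \<noteq> 0 \<Longrightarrow> coprime (int n) (det A)"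
    let ?F = "\<lambda>v. vec d (\<lambda>i. (row A i \<bullet> v) mod int n)"
    have copA: "coprime (int n) (det A)" using cop A by blast
    have sol: "(\<forall>s\<in>S. [s \<bullet> v = 0] (mod int n)) \<longleftrightarrow> (\<forall>i\<in>K. ?F v $ i = 0)"
      if v: "v \<in> carrier_vec d" for v
    proof -
      have "(\<forall>i\<in>K. ?F v $ i = 0) \<longleftrightarrow> (\<forall>i\<in>K. [row A i \<bullet> v = 0] (mod int n))"
        using K by (intro ball_cong) (auto simp: cong_def)
      also have "\<dots> \<longleftrightarrow> (\<forall>s\<in>S. [s \<bullet> v = 0] (mod int n))"
      proof (intro iffI ballI)
        fix s assume rows: "\<forall>i\<in>K. [row A i \<bullet> v = 0] (mod int n)" and s: "s \<in> S"
        have "[det A * (s \<bullet> v) = (\<Sum>i\<in>K. det (replace_row A i s) * 0)] (mod int n)"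
          unfolding expand[OF s v] using rows by (intro cong_sum cong_mult cong_refl) auto
        then have "[det A * (s \<bullet> v) = det A * 0] (mod int n)" by simp
        then show "[s \<bullet> v = 0] (mod int n)"
          using copA by (subst (asm) cong_mult_lcancel) (auto simp: coprime_commute)
      qed (auto simp: K_def rows_in_def)
      finally show ?thesis by simp
    qed
    have "card (solutions_mod n d S) = card {w \<in> Zn_vectors n d. \<forall>i\<in>K. w $ i = 0}"
    proof (rule bij_betw_same_card)
      have "{w \<in> Zn_vectors n d. \<forall>i\<in>K. w $ i = 0} = ?F ` solutions_mod n d S"
      proof -
        \<comment> \<open>By surjectivity every \<open>w\<close> is some \<open>?F v\<close>, so the
          condition on \<open>w\<close> pulls back to one on \<open>v\<close>.\<close>
        have surj: "?F ` Zn_vectors n d = Zn_vectors n d"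
          using scalar_prod_mod_bij[OF Ac n copA] by (simp add: bij_betw_def)
        have "{w \<in> ?F ` Zn_vectors n d. \<forall>i\<in>K. w $ i = 0} =
            ?F ` {v \<in> Zn_vectors n d. \<forall>i\<in>K. ?F v $ i = 0}" by blast
        then have "{w \<in> Zn_vectors n d. \<forall>i\<in>K. w $ i = 0} =
            ?F ` {v \<in> Zn_vectors n d. \<forall>i\<in>K. ?F v $ i = 0}" unfolding surj .
        also have "{v \<in> Zn_vectors n d. \<forall>i\<in>K. ?F v $ i = 0} = solutions_mod n d S"
          using sol by (auto simp: solutions_mod_def Zn_vectors_def)
        finally show ?thesis .
      qed
      then show "bij_betw ?F (solutions_mod n d S) {w \<in> Zn_vectors n d. \<forall>i\<in>K. w $ i = 0}"
        using bij_betw_subset[OF scalar_prod_mod_bij[OF Ac n copA], of "solutions_mod n d S"]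
        by (auto simp: solutions_mod_def)
    qed
    also have "\<dots> = n ^ (d - card K)"
      by (rule card_Zn_vectors_zero_on[OF n K])
    finally show "card (solutions_mod n d S) = n ^ (d - card K)" .
  qed simp
qed

section \<open>Zero-sum-freeness and inclusion-exclusion\<close>

lemma zero_one_vectors_nonzero_eq_image:
  "zero_one_vectors d - {0\<^sub>v d} =
    (\<lambda>I. vec d (\<lambda>i. of_bool (i \<in> I))) ` (Pow {..<d} - {{}})"
proof (intro equalityI subsetI)
  fix s assume s: "s \<in> zero_one_vectors d - {0\<^sub>v d}"
  define I where "I = {i. i < d \<and> s $ i = 1}"
  have s_eq: "s = vec d (\<lambda>i. of_bool (i \<in> I))"
    using s by (intro eq_vecI) (auto simp: I_def zero_one_vectors_def)
  moreover have "I \<noteq> {}"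
  proof
    assume "I = {}"
    with s_eq have "s = 0\<^sub>v d" by auto
    with s show False by simp
  qed
  ultimately show "s \<in> (\<lambda>I. vec d (\<lambda>i. of_bool (i \<in> I))) ` (Pow {..<d} - {{}})"
    by (intro image_eqI[of _ _ I]) (auto simp: I_def)
next
  fix s :: "int vec" assume "s \<in> (\<lambda>I. vec d (\<lambda>i. of_bool (i \<in> I))) ` (Pow {..<d} - {{}})"
  then obtain I i where s: "s = vec d (\<lambda>i. of_bool (i \<in> I))" and i: "i \<in> I" "i < d"
    by auto
  have "s \<noteq> 0\<^sub>v d"
    using s i by (auto dest!: arg_cong[of _ _ "\<lambda>x. x $ i"])
  then show "s \<in> zero_one_vectors d - {0\<^sub>v d}"
    by (auto simp: s zero_one_vectors_def)
qed

text \<open>A subset sum over \<open>I\<close> is the scalar product with the indicator vector of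
  \<open>I\<close>, and nonempty \<open>I\<close> correspond to nonzero vectors.\<close>

lemma zero_sum_free_iff:
  assumes v: "v \<in> carrier_vec d"
  shows "zero_sum_free n v \<longleftrightarrow>
    (\<forall>s\<in>zero_one_vectors d - {0\<^sub>v d}. \<not> [s \<bullet> v = 0] (mod int n))"
proof -
  have "vec d (\<lambda>i. of_bool (i \<in> I)) \<bullet> v = (\<Sum>i\<in>I. v $ i)" if "I \<subseteq> {..<d}" for I
  proof -
    have "vec d (\<lambda>i. of_bool (i \<in> I)) \<bullet> v = (\<Sum>i<d. if i \<in> I then v $ i else 0)"
      unfolding scalar_prod_def using v by (intro sum.cong) auto
    also have "\<dots> = (\<Sum>i\<in>I. v $ i)"
      using that by (simp add: sum.inter_restrict[symmetric] Int_absorb1)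
    finally show ?thesis .
  qed
  then show ?thesis
    using v by (auto simp: zero_sum_free_def zero_one_vectors_nonzero_eq_image)
qed

lemma finite_zero_one_vectors [simp]: "finite (zero_one_vectors d)"
proof (rule finite_subset)
  \<comment> \<open>The entries 0 and 1 are the canonical residues modulo 2.\<close>
  show "zero_one_vectors d \<subseteq> Zn_vectors 2 d"
    by (auto simp: zero_one_vectors_def Zn_vectors_def)
qed simp

text \<open>The indicator of zero-sum-freeness is the product over \<open>s\<close> of 1 minus the
  indicator of orthogonality to \<open>s\<close>; expand it over subsets and exchange the
  sums.\<close>

lemma alpha_inclusion_exclusion:
  "int (alpha n d) = (\<Sum>S\<in>Pow (zero_one_vectors d - {0\<^sub>v d}).
    (- 1) ^ card S * int (card (solutions_mod n d S)))"
proof -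
  let ?T = "zero_one_vectors d - {0\<^sub>v d}"
  let ?z = "\<lambda>v s. of_bool ([s \<bullet> v = 0] (mod int n)) :: int"
  have prod_of_bool: "(\<Prod>s\<in>S. of_bool (P s)) = (of_bool (\<forall>s\<in>S. P s) :: int)"
    if "finite S" for S :: "int vec set" and P
    using that by induction auto
  have "int (alpha n d) = (\<Sum>v\<in>Zn_vectors n d. of_bool (zero_sum_free n v))"
    by (simp add: alpha_def Int_def)
  also have "\<dots> = (\<Sum>v\<in>Zn_vectors n d. \<Prod>s\<in>?T. 1 - ?z v s)"
  proof (rule sum.cong)
    fix v assume "v \<in> Zn_vectors n d"
    then have "v \<in> carrier_vec d" by (simp add: Zn_vectors_def)
    then show "of_bool (zero_sum_free n v) = (\<Prod>s\<in>?T. 1 - ?z v s)"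
      by (simp add: zero_sum_free_iff prod_of_bool of_bool_not_iff[symmetric]
          del: of_bool_not_iff)
  qed simp
  also have "\<dots> = (\<Sum>v\<in>Zn_vectors n d. \<Sum>S\<in>Pow ?T. (- 1) ^ card S * (\<Prod>s\<in>S. ?z v s))"
    by (simp add: prod_diff_conv_sum)
  also have "\<dots> = (\<Sum>S\<in>Pow ?T. (- 1) ^ card S * (\<Sum>v\<in>Zn_vectors n d. \<Prod>s\<in>S. ?z v s))"
    by (subst sum.swap) (simp add: sum_distrib_left)
  also have "\<dots> = (\<Sum>S\<in>Pow ?T. (- 1) ^ card S * int (card (solutions_mod n d S)))"
  proof (rule sum.cong)
    fix S assume "S \<in> Pow ?T"
    then have "finite S" by (auto intro: finite_subset[of _ ?T])
    then show "(- 1) ^ card S * (\<Sum>v\<in>Zn_vectors n d. \<Prod>s\<in>S. ?z v s) =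
        (- 1) ^ card S * int (card (solutions_mod n d S))"
      by (simp add: prod_of_bool solutions_mod_def Int_def)
  qed simp
  finally show ?thesis .
qed

section \<open>Assembling the monic polynomial\<close>

theorem theorem3p4:
  fixes d :: nat
  assumes "d > 0"
  shows "\<exists>f :: int poly. degree f = d \<and> lead_coeff f = 1 \<and>
    (\<forall>n :: nat. n > 0 \<and>
        (\<forall>A \<in> zero_one_matrices d. det A \<noteq> 0 \<longrightarrow> coprime (int n) (det A))
      \<longrightarrow> int (alpha n d) = poly f (int n))"
proof -
  let ?T = "zero_one_vectors d - {0\<^sub>v d}"
  let ?good = "\<lambda>n. n > 0 \<and>
    (\<forall>A \<in> zero_one_matrices d. det A \<noteq> 0 \<longrightarrow> coprime (int n) (det A))"
  have "\<exists>r. (S \<noteq> {} \<longrightarrow> r < d) \<and> (\<forall>n. ?good n \<longrightarrow> card (solutions_mod n d S) = n ^ r)"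
    if "S \<in> Pow ?T" for S
  proof -
    have "S \<subseteq> zero_one_vectors d" "0\<^sub>v d \<notin> S" using that by auto
    then show ?thesis by (metis card_solutions_mod)
  qed
  then obtain r where r_less: "\<And>S. S \<in> Pow ?T \<Longrightarrow> S \<noteq> {} \<Longrightarrow> r S < d"
    and r_card: "\<And>S n. S \<in> Pow ?T \<Longrightarrow> ?good n \<Longrightarrow> card (solutions_mod n d S) = n ^ r S"
    by metis
  \<comment> \<open>The empty \<open>S\<close> is kept apart: it yields the leading term
    \<open>monom 1 d\<close>, while all other terms have degree below \<open>d\<close>.\<close>
  define g :: "int poly" where "g = (\<Sum>S\<in>Pow ?T - {{}}. monom ((- 1) ^ card S) (r S))"
  have "degree (monom ((- 1 :: int) ^ card S) (r S)) < d" if "S \<in> Pow ?T - {{}}" for S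
    using r_less[of S] that by (auto intro: le_less_trans[OF degree_monom_le])
  then have deg_g: "degree g < d"
    unfolding g_def using assms by (intro degree_sum_less) auto
  define f where "f = monom 1 d + g"
  have deg_f: "degree f = d"
    unfolding f_def using deg_g by (simp add: degree_add_eq_left degree_monom_eq)
  have "lead_coeff f = 1"
    unfolding deg_f using deg_g by (simp add: f_def coeff_eq_0)
  moreover have "int (alpha n d) = poly f (int n)" if n: "?good n" for n
  proof -
    \<comment> \<open>The empty system admits every vector.\<close>
    have "card (solutions_mod n d {}) = n ^ d"
      using card_Zn_vectors_zero_on[of n "{}" d] n by (simp add: solutions_mod_def)
    moreover have "int (card (solutions_mod n d S)) = int n ^ r S" if "S \<in> Pow ?T - {{}}" for S
      using r_card[of S n] n that by simp
    ultimately show ?thesis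
      by (simp add: alpha_inclusion_exclusion f_def g_def poly_monom poly_sum
          sum.remove[of "Pow ?T" "{}"])
  qed
  ultimately show ?thesis
    using deg_f by blast
qed

end
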